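(* Let $x^0\in\mathrm{dom}(F)$ and $\epsilon>0$ be given. Then the inexact damped Newton (DN) method (described in the context) for solving $\min_x\{f(x)+g(x)\}$ with $g=0$ requires at most $$\min\left\{\left\lceil\left[\frac{\log(\frac12\omega(1/6))-\log\delta_0}{\log\left(1-\frac{1-\omega_*^{-1}(\delta_0)}{2(1+\omega_*^{-1}(\delta_0))}\right)}\right]_+\right\rceil,\ \left\lceil\frac{2\delta_0}{\omega(1/6)}\right\rceil\right\}+\left\lceil\log_2\left(\frac{2\omega(1/6)}{\epsilon}\right)\right\rceil$$ iterations for finding some $x^k$ satisfying $F(x^k)-F^*\le\epsilon$, where $\delta_0=F(x^0)-F^*$.
   Context: Problem and standing assumptions. Here $g=0$, so $F=f$ and $F^*=\min_{x\in\mathbb{R}^N}f(x)$, where $f:\mathbb{R}^N\to\mathbb{R}\cup\{\infty\}$ is standard self-concordant: it is a closed convex function with open domain $\mathrm{dom}(f)$, three times continuously differentiable on $\mathrm{dom}(f)$, and $|\psi'''(0)|\le 2(\psi''(0))^{3/2}$ for all $x\in\mathrm{dom}(f)$, $u\in\mathbb{R}^N$, where $\psi(t)=f(x+tu)$. Also $\nabla^2 f$ is positive definite on $\mathrm{dom}(F)$, and the problem has a unique optimal solution $x^*$ (so $F^*=F(x^* )$). Notation. $\tilde d(x):=-(\nabla^2 f(x))^{-1}\nabla f(x)$ and $\tilde\lambda(x):=\sqrt{\langle\tilde d(x),\nabla^2 f(x)\tilde d(x)\rangle}$; $\omega(t):=t-\ln(1+t)$; $\omega_*(t):=-t-\ln(1-t)$;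 $\omega_*^{-1}:[0,\infty)\to[0,1)$ is the inverse of $\omega_*$ restricted to $[0,1)$; $[t]_+:=\max(t,0)$. Inexact DN method (Zhang and Xiao). Starting at $x^0$, it generates iterates in $\mathrm{dom}(F)$ by $x^{k+1}=x^k+\hat d(x^k)/(1+\hat\lambda(x^k))$, $k\ge0$, where $\hat d(x^k)$ is an approximation to $\tilde d(x^k)$ and $\hat\lambda(x^k)=\sqrt{\langle\hat d(x^k),\nabla^2 f(x^k)\hat d(x^k)\rangle}$. The approximation is accurate enough that the iterates satisfy the following two properties (established by Zhang and Xiao for their method and taken as given): $F(x^{k+1})\le F(x^k)-\frac12\omega(\tilde\lambda(x^k))$ for all $k\ge0$; and $\omega(\tilde\lambda(x^{k+1}))\le\frac12\omega(\tilde\lambda(x^k))$ whenever $\tilde\lambda(x^k)\le1/6$. *)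

theory Defs
  imports "HOL-Analysis.Analysis"
begin

text \<open>A function from \<open>\<real>\<^sup>N\<close> to \<open>\<real> \<union> {\<infinity>}\<close> is an \<open>ereal\<close>-valued function that never takes the
  value \<open>-\<infinity>\<close>. Derivatives are those of its real part \<open>fin f\<close>, which is meaningful on the open
  set \<open>dom_of f\<close>.\<close>

definition dom_of :: "('a \<Rightarrow> ereal) \<Rightarrow> 'a set" where
  "dom_of f = {x. f x < \<infinity>}"

definition fin :: "('a \<Rightarrow> ereal) \<Rightarrow> 'a \<Rightarrow> real" where
  "fin f x = real_of_ereal (f x)"

definition closed_convex_fun :: "('a::euclidean_space \<Rightarrow> ereal) \<Rightarrow> bool" where
  "closed_convex_fun f \<longleftrightarrow>
     (\<forall>x. f x \<noteq> -\<infinity>) \<and> convex_on (dom_of f) (fin f) \<and> closed (epigraph (dom_of f) (fin f))"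

text \<open>\<open>k\<close> times continuously differentiable on an open set: all iterated directional derivatives
  up to order \<open>k\<close> exist, arise from Frechet derivatives and are continuous.\<close>

primrec cont_diff_on :: "nat \<Rightarrow> ('a::euclidean_space \<Rightarrow> real) \<Rightarrow> 'a set \<Rightarrow> bool" where
  "cont_diff_on 0 f S \<longleftrightarrow> continuous_on S f"
| "cont_diff_on (Suc k) f S \<longleftrightarrow>
     (\<forall>x\<in>S. f differentiable (at x)) \<and>
     (\<forall>v. cont_diff_on k (\<lambda>x. frechet_derivative f (at x) v) S)"

definition std_self_concordant :: "('a::euclidean_space \<Rightarrow> ereal) \<Rightarrow> bool" where
  "std_self_concordant f \<longleftrightarrow>
     closed_convex_fun f \<and> open (dom_of f) \<and> cont_diff_on 3 (fin f) (dom_of f) \<and>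
     (\<forall>x\<in>dom_of f. \<forall>u. let \<psi> = (\<lambda>t::real. fin f (x + t *\<^sub>R u)) in
        \<bar>(deriv ^^ 3) \<psi> 0\<bar> \<le> 2 * ((deriv ^^ 2) \<psi> 0) powr (3/2))"

definition grad :: "(real^'n \<Rightarrow> ereal) \<Rightarrow> real^'n \<Rightarrow> real^'n" where
  "grad f x = (THE g. GDERIV (fin f) x :> g)"

definition hess :: "(real^'n \<Rightarrow> ereal) \<Rightarrow> real^'n \<Rightarrow> real^'n^'n" where
  "hess f x = jacobian (grad f) (at x)"

definition pos_def :: "real^'n^'n \<Rightarrow> bool" where
  "pos_def A \<longleftrightarrow> transpose A = A \<and> (\<forall>v. v \<noteq> 0 \<longrightarrow> 0 < v \<bullet> (A *v v))"

definition local_norm :: "(real^'n \<Rightarrow> ereal) \<Rightarrow> real^'n \<Rightarrow> real^'n \<Rightarrow> real" where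
  "local_norm f x d = sqrt (d \<bullet> (hess f x *v d))"

definition newton_dir :: "(real^'n \<Rightarrow> ereal) \<Rightarrow> real^'n \<Rightarrow> real^'n" where
  "newton_dir f x = - (matrix_inv (hess f x) *v grad f x)"

definition newton_dec :: "(real^'n \<Rightarrow> ereal) \<Rightarrow> real^'n \<Rightarrow> real" where
  "newton_dec f x = local_norm f x (newton_dir f x)"

definition opt_val :: "('a \<Rightarrow> ereal) \<Rightarrow> ereal" where
  "opt_val f = (INF x. f x)"

definition omega :: "real \<Rightarrow> real" where
  "omega t = t - ln (1 + t)"

definition omega_star :: "real \<Rightarrow> real" where
  "omega_star t = - t - ln (1 - t)"

text \<open>Only meaningful on \<open>[0,\<infinity>)\<close>, the image of \<open>[0,1)\<close> under \<^const>\<open>omega_star\<close>.\<close>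

definition omega_star_inv :: "real \<Rightarrow> real" where
  "omega_star_inv = the_inv_into {0..<1} omega_star"

text \<open>The directions \<open>dhat k\<close> are an arbitrary sequence here; how accurately they have to approximate
  the Newton directions is a separate assumption.\<close>

definition inexact_DN ::
    "(real^'n \<Rightarrow> ereal) \<Rightarrow> real^'n \<Rightarrow> (nat \<Rightarrow> real^'n) \<Rightarrow> (nat \<Rightarrow> real^'n) \<Rightarrow> bool" where
  "inexact_DN f x0 dhat x \<longleftrightarrow>
     x 0 = x0 \<and>
     (\<forall>k. x k \<in> dom_of f \<and>
          x (Suc k) = x k + (1 / (1 + local_norm f (x k) (dhat k))) *\<^sub>R dhat k)"

end

theory Submission
  imports Defs
begin

text \<open>Write \<open>\<delta>\<close> for the gap between the value of an iterate and the optimal value, \<open>\<lambda>\<close> for its Newton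
  decrement and \<open>W = omega (1/6)\<close>. Everything rests on one consequence of self-concordance: if
  \<open>\<lambda> < 1\<close> then \<open>\<delta> \<le> omega_star \<lambda>\<close> (\<open>gap_le_omega_star\<close>). It comes from the lower bound
  \<open>f (y + u) \<ge> f y + f'(y) u + omega r\<close>, where \<open>r\<close> is the local norm of \<open>u\<close> at \<open>y\<close>; this bound is a
  differential inequality on a segment (\<open>self_concordant_line_lower_bound\<close>). Since \<open>f'(y) u \<ge> - \<lambda> * r\<close>,
  the Young inequality for \<open>omega\<close> and \<open>omega_star\<close> yields the estimate.

  The estimate is used twice. Read as a lower bound on \<open>\<lambda>\<close> it shows that
  \<open>omega \<lambda> \<ge> (1 - s) / (1 + s) * \<delta>\<close> with \<open>s = omega_star_inv \<delta>0\<close> (\<open>omega_lower_linear\<close>), so that a decrease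
  of \<open>omega \<lambda> / 2\<close> per iteration makes \<open>\<delta>\<close> contract geometrically. Read as an upper bound on \<open>\<delta>\<close>
  it gives \<open>\<delta> \<le> 2 * omega \<lambda>\<close> when \<open>\<lambda> \<le> 1/6\<close>, so that the halving of \<open>omega \<lambda>\<close> near the optimum
  transfers to \<open>\<delta>\<close>.

  What is left is to count (\<open>two_phase_within\<close>). The regime \<open>\<lambda> \<le> 1/6\<close> begins at the latest when the
  geometric contraction has brought \<open>\<delta>\<close> down to \<open>W / 2\<close>, and also at the latest when steps that
  decrease \<open>\<delta>\<close> by more than \<open>W / 2\<close> would have exhausted the initial gap; these are the two arguments of
  the minimum. From there on \<open>\<delta> \<le> 2 * W / 2 ^ j\<close> after \<open>j\<close> more iterations, which accounts for
  the logarithm of \<open>2 * W / \<epsilon>\<close>.\<close>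

section \<open>The functions omega and omega-star\<close>

lemma omega_deriv:
  assumes "t > -1"
  shows "(omega has_real_derivative t / (1 + t)) (at t)"
  unfolding omega_def using assms by (auto intro!: derivative_eq_intros simp: field_simps)

lemma omega_star_deriv:
  assumes "t < 1"
  shows "(omega_star has_real_derivative t / (1 - t)) (at t)"
  unfolding omega_star_def using assms by (auto intro!: derivative_eq_intros simp: field_simps)

lemma omega_nonneg: "omega t \<ge> 0" if "t > -1"
  unfolding omega_def using ln_add_one_self_le_self2[OF that] by simp

lemma omega_strict_mono:
  assumes "0 \<le> s" "s < t"
  shows "omega s < omega t"
proof (rule DERIV_pos_imp_increasing_open[OF assms(2)])
  show "\<exists>y. (omega has_real_derivative y) (at u) \<and> 0 < y" if "s < u" "u < t" for u
    using omega_deriv[of u] that assms by (intro exI[of _ "u / (1 + u)"]) auto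
  show "continuous_on {s..t} omega"
    by (rule DERIV_continuous_on[of _ _ "\<lambda>u. u / (1 + u)"])
       (use assms in \<open>auto intro!: has_field_derivative_at_within omega_deriv\<close>)
qed

lemma omega_star_strict_mono:
  assumes "0 \<le> s" "s < t" "t < 1"
  shows "omega_star s < omega_star t"
proof (rule DERIV_pos_imp_increasing_open[OF assms(2)])
  show "\<exists>y. (omega_star has_real_derivative y) (at u) \<and> 0 < y" if "s < u" "u < t" for u
    using omega_star_deriv[of u] that assms by (intro exI[of _ "u / (1 - u)"]) auto
  show "continuous_on {s..t} omega_star"
    by (rule DERIV_continuous_on[of _ _ "\<lambda>u. u / (1 - u)"])
       (use assms in \<open>auto intro!: has_field_derivative_at_within omega_star_deriv\<close>)
qed

lemma omega_star_inj: "inj_on omega_star {0..<1}"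
  by (rule linorder_inj_onI') (use omega_star_strict_mono in force)

lemma omega_mono: "omega s \<le> omega t" if "0 \<le> s" "s \<le> t"
  using omega_strict_mono[of s t] that by (cases "s = t") auto

lemma omega_star_mono: "omega_star s \<le> omega_star t" if "0 \<le> s" "s \<le> t" "t < 1"
  using omega_star_strict_mono[of s t] that by (cases "s = t") auto

lemma omega_star_surj:
  assumes "d \<ge> 0"
  shows "\<exists>t\<in>{0..<1}. omega_star t = d"
proof -
  \<comment> \<open>Here \<open>omega_star ?T = d + exp (- (d + 1))\<close>, so the intermediate value theorem applies on \<open>[0, ?T]\<close>.\<close>
  let ?T = "1 - exp (- (d + 1))"
  have T: "0 \<le> ?T" "?T < 1" using assms by auto
  have "\<exists>t\<ge>0. t \<le> ?T \<and> omega_star t = d"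
  proof (rule IVT')
    show "omega_star 0 \<le> d" "d \<le> omega_star ?T" "0 \<le> ?T" using assms
      by (auto simp: omega_star_def)
    show "continuous_on {0..?T} omega_star"
      by (rule DERIV_continuous_on[of _ _ "\<lambda>u. u / (1 - u)"])
         (meson T(2) atLeastAtMost_iff has_field_derivative_at_within le_less_trans omega_star_deriv)
  qed
  then obtain t where "0 \<le> t" "t \<le> ?T" "omega_star t = d" by blast
  thus ?thesis using le_less_trans[OF _ T(2)] by (intro bexI[of _ t]) (simp_all only: atLeastLessThan_iff)
qed

lemma omega_star_inv_props:
  assumes "d \<ge> 0"
  shows "0 \<le> omega_star_inv d" "omega_star_inv d < 1" "omega_star (omega_star_inv d) = d"
proof -
  have d: "d \<in> omega_star ` {0..<1}" using omega_star_surj[OF assms] by force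
  have "omega_star_inv d \<in> {0..<1}"
    unfolding omega_star_inv_def by (rule the_inv_into_into[OF omega_star_inj d]) simp
  thus "0 \<le> omega_star_inv d" "omega_star_inv d < 1" by auto
  show "omega_star (omega_star_inv d) = d"
    unfolding omega_star_inv_def by (rule f_the_inv_into_f[OF omega_star_inj d])
qed

text \<open>The Young inequality for the conjugate pair \<open>omega\<close>, \<open>omega_star\<close>. Both logarithms combine into
  one, so the difference of the two sides is itself a value of \<open>omega\<close>, namely at
  \<open>(1 + r) * (1 - l) - 1\<close>.\<close>

lemma omega_fenchel_young:
  assumes "r \<ge> 0" "l < 1"
  shows "l * r \<le> omega r + omega_star l"
proof -
  let ?y = "(1 + r) * (1 - l) - 1"
  have "ln (1 + ?y) = ln (1 + r) + ln (1 - l)"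
    using assms by (simp add: ln_mult)
  hence "omega r + omega_star l - l * r = omega ?y"
    by (simp add: omega_def omega_star_def algebra_simps)
  moreover have "omega ?y \<ge> 0"
    using assms by (intro omega_nonneg) (simp add: mult_pos_pos)
  ultimately show ?thesis by linarith
qed

text \<open>The derivatives \<open>t / (1 + t)\<close> and \<open>t / (1 - t)\<close> have the decreasing quotient
  \<open>(1 - t) / (1 + t)\<close>, hence the functions have at least this quotient at \<open>t\<close>. In product form
  this is the monotonicity of \<open>(1 + t) * omega t - (1 - t) * omega_star t\<close>, whose
  derivative is \<open>omega t + omega_star t\<close>.\<close>

lemma omega_star_le_omega:
  assumes "0 \<le> t" "t < 1"
  shows "(1 - t) / (1 + t) * omega_star t \<le> omega t"
proof -
  let ?D = "\<lambda>t. (1 + t) * omega t - (1 - t) * omega_star t"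
  have "?D 0 \<le> ?D t"
  proof (rule DERIV_nonneg_imp_nondecreasing[OF assms(1), of ?D])
    fix u assume u: "0 \<le> u" "u \<le> t"
    have ne: "1 + u \<noteq> 0" "1 - u \<noteq> 0" using u assms by auto
    have "(?D has_real_derivative
             (omega u + (1 + u) * (u / (1 + u))) - ((1 - u) * (u / (1 - u)) - omega_star u)) (at u)"
      using u assms by (auto intro!: derivative_eq_intros omega_deriv omega_star_deriv)
    hence "(?D has_real_derivative (omega u + u) - (u - omega_star u)) (at u)"
      using ne by simp
    moreover have "omega_star 0 \<le> omega_star u" using u assms by (intro omega_star_mono) auto
    ultimately show "\<exists>y. (?D has_real_derivative y) (at u) \<and> 0 \<le> y"
      using u omega_nonneg[of u] by (intro exI[of _ "(omega u + u) - (u - omega_star u)"])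
        (auto simp: omega_star_def)
  qed
  thus ?thesis using assms by (simp add: omega_def omega_star_def field_simps)
qed

text \<open>This turns a gap \<open>d\<close> into a decrease proportional to \<open>d\<close>. The hypotheses imply that \<open>lam\<close> is at
  least \<open>t = omega_star_inv d\<close>, so that \<open>omega lam\<close> is at least
  \<open>omega t \<ge> (1 - t) / (1 + t) * d\<close>; replacing \<open>t\<close> by the larger \<open>omega_star_inv d0\<close> makes the factor
  the same for all gaps up to \<open>d0\<close>.\<close>

lemma omega_lower_linear:
  assumes "0 \<le> lam" "0 \<le> d" "d \<le> d0" "lam < 1 \<Longrightarrow> d \<le> omega_star lam"
  shows "(1 - omega_star_inv d0) / (1 + omega_star_inv d0) * d \<le> omega lam"
proof -
  define t s where "t = omega_star_inv d" and "s = omega_star_inv d0"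
  note tp = omega_star_inv_props[OF \<open>0 \<le> d\<close>, folded t_def]
  have sp: "0 \<le> s" "s < 1" "omega_star s = d0"
    unfolding s_def using assms by (auto intro!: omega_star_inv_props)
  have "t \<le> s"
    using omega_star_strict_mono[of s t] tp sp assms by force
  have "t \<le> lam"
    using omega_star_strict_mono[of lam t] tp assms by force
  have "(1 - s) / (1 + s) * d \<le> (1 - t) / (1 + t) * d"
    using \<open>t \<le> s\<close> tp sp assms by (intro mult_right_mono) (auto simp: field_simps)
  also have "\<dots> \<le> omega t" using omega_star_le_omega[of t] tp by auto
  also have "\<dots> \<le> omega lam" using \<open>t \<le> lam\<close> tp by (intro omega_mono) auto
  finally show ?thesis unfolding s_def .
qed

section \<open>Self-concordant functions along a segment\<close>

text \<open>Self-concordance bounds the derivative of \<open>1 / sqrt (p2 t)\<close> by \<open>1\<close>. Hence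
  \<open>1 / sqrt (p2 t) \<le> 1 / r + t\<close> with \<open>r = sqrt (p2 0)\<close>, that is,
  \<open>p2 t \<ge> r\<^sup>2 / (1 + r * t)\<^sup>2\<close>, and integrating twice gives \<open>omega r\<close>. Each integration is carried out as
  monotonicity of the difference of the two sides.\<close>

lemma self_concordant_line_lower_bound:
  fixes p p1 p2 p3 :: "real \<Rightarrow> real"
  assumes d: "\<And>t. t \<in> {0..1} \<Longrightarrow> (p has_real_derivative p1 t) (at t)"
             "\<And>t. t \<in> {0..1} \<Longrightarrow> (p1 has_real_derivative p2 t) (at t)"
             "\<And>t. t \<in> {0..1} \<Longrightarrow> (p2 has_real_derivative p3 t) (at t)"
    and pos: "\<And>t. t \<in> {0..1} \<Longrightarrow> p2 t > 0"
    and sc: "\<And>t. t \<in> {0..1} \<Longrightarrow> - (2 * p2 t powr (3/2)) \<le> p3 t"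
  shows "p 0 + p1 0 + omega (sqrt (p2 0)) \<le> p 1"
proof -
  define r where "r = sqrt (p2 0)"
  have r: "r > 0" using pos[of 0] by (simp add: r_def)
  have phi: "1 / sqrt (p2 t) \<le> 1 / r + t" if t: "t \<in> {0..1}" for t
  proof -
    let ?g = "\<lambda>t. t - 1 / sqrt (p2 t)"
    have "?g 0 \<le> ?g t"
    proof (rule DERIV_nonneg_imp_nondecreasing[of 0 t ?g])
      show "0 \<le> t" using t by simp
      fix u assume u: "0 \<le> u" "u \<le> t"
      hence u1: "u \<in> {0..1}" using t by auto
      note P = pos[OF u1]
      have pw: "p2 u powr (3/2) = p2 u * sqrt (p2 u)"
        using P powr_add[of "p2 u" 1 "1/2"] by (simp add: powr_half_sqrt)
      have "(?g has_real_derivative 1 + p3 u / (2 * (p2 u * sqrt (p2 u)))) (at u)"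
        using P by (auto intro!: derivative_eq_intros d(3)[OF u1] simp: field_simps)
      moreover have "0 \<le> 1 + p3 u / (2 * (p2 u * sqrt (p2 u)))"
        using sc[OF u1] P unfolding pw by (simp add: field_simps)
      ultimately show "\<exists>y. (?g has_real_derivative y) (at u) \<and> 0 \<le> y" by blast
    qed
    thus ?thesis by (simp add: r_def)
  qed
  have low2: "r\<^sup>2 / (1 + r * t)\<^sup>2 \<le> p2 t" if t: "t \<in> {0..1}" for t
  proof -
    have "r / (1 + r * t) \<le> sqrt (p2 t)"
      using phi[OF t] r pos[OF t] t by (simp add: divide_le_eq add_pos_nonneg) (simp add: field_simps)
    hence "(r / (1 + r * t))\<^sup>2 \<le> (sqrt (p2 t))\<^sup>2"
      using r t by (intro power_mono) auto
    thus ?thesis using pos[OF t] by (simp add: power_divide)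
  qed
  have low1: "p1 0 + r - r / (1 + r * t) \<le> p1 t" if t: "t \<in> {0..1}" for t
  proof -
    let ?g = "\<lambda>t. p1 t + r / (1 + r * t)"
    have "?g 0 \<le> ?g t"
    proof (rule DERIV_nonneg_imp_nondecreasing[of 0 t ?g])
      show "0 \<le> t" using t by simp
      fix u assume u: "0 \<le> u" "u \<le> t"
      hence u1: "u \<in> {0..1}" using t by auto
      have ne: "1 + r * u > 0" using r u by (simp add: add_pos_nonneg)
      have "(?g has_real_derivative p2 u - r\<^sup>2 / (1 + r * u)\<^sup>2) (at u)"
        using ne by (auto intro!: derivative_eq_intros d(2)[OF u1] simp: power2_eq_square)
      thus "\<exists>y. (?g has_real_derivative y) (at u) \<and> 0 \<le> y"
        using low2[OF u1] by (intro exI[of _ "p2 u - r\<^sup>2 / (1 + r * u)\<^sup>2"]) auto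
    qed
    thus ?thesis by simp
  qed
  let ?g = "\<lambda>t. p t - (p1 0 + r) * t + ln (1 + r * t)"
  have "?g 0 \<le> ?g 1"
  proof (rule DERIV_nonneg_imp_nondecreasing[of 0 1 ?g])
    fix u :: real assume u: "0 \<le> u" "u \<le> 1"
    hence u1: "u \<in> {0..1}" by auto
    have ne: "1 + r * u > 0" using r u by (simp add: add_pos_nonneg)
    have "(?g has_real_derivative p1 u - (p1 0 + r) + r / (1 + r * u)) (at u)"
      using ne by (auto intro!: derivative_eq_intros d(1)[OF u1])
    thus "\<exists>y. (?g has_real_derivative y) (at u) \<and> 0 \<le> y"
      using low1[OF u1] by (intro exI[of _ "p1 u - (p1 0 + r) + r / (1 + r * u)"]) auto
  qed simp
  thus ?thesis by (simp add: omega_def r_def)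
qed

definition dir_deriv :: "'a::euclidean_space \<Rightarrow> ('a \<Rightarrow> real) \<Rightarrow> 'a \<Rightarrow> real" where
  "dir_deriv u F x = frechet_derivative F (at x) u"

lemma has_real_derivative_along_line:
  assumes "F differentiable (at (x + t *\<^sub>R u))"
  shows "((\<lambda>t. F (x + t *\<^sub>R u)) has_real_derivative dir_deriv u F (x + t *\<^sub>R u)) (at t)"
proof -
  let ?D = "frechet_derivative F (at (x + t *\<^sub>R u))"
  have D: "(F has_derivative ?D) (at (x + t *\<^sub>R u))"
    using assms frechet_derivative_works by blast
  have "((\<lambda>t. x + t *\<^sub>R u) has_derivative (\<lambda>h. h *\<^sub>R u)) (at t)"
    by (auto intro!: derivative_eq_intros)
  from has_derivative_compose[OF this D]
  have "((\<lambda>t. F (x + t *\<^sub>R u)) has_derivative (\<lambda>h. ?D (h *\<^sub>R u))) (at t)" .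
  moreover have "?D (h *\<^sub>R u) = h * ?D u" for h
    using linear_cmul[OF has_derivative_linear[OF D], of h u] by simp
  ultimately show ?thesis
    by (simp add: has_field_derivative_def dir_deriv_def mult.commute[of _ "?D u"])
qed

lemma deriv_eq_on_open:
  assumes "open T" "t \<in> T" "\<And>s. s \<in> T \<Longrightarrow> g s = h s" "(h has_field_derivative D) (at t)"
  shows "deriv g t = D"
proof -
  have "(g has_field_derivative D) (at t)"
    by (rule has_field_derivative_transform_within_open[OF assms(4,1,2)]) (use assms(3) in auto)
  thus ?thesis by (rule DERIV_imp_deriv)
qed

lemma cont_diff_on_3D:
  assumes "cont_diff_on 3 F S" "x \<in> S"
  shows "F differentiable (at x)" "dir_deriv u F differentiable (at x)"
    "dir_deriv u (dir_deriv u F) differentiable (at x)"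
  using assms unfolding numeral_3_eq_3 by (auto simp: dir_deriv_def[abs_def])

text \<open>Passes from the iterated derivatives at \<open>0\<close> along a line, in which self-concordance is stated, to
  iterated directional derivatives. The latter can be evaluated at every point of a line, so that the
  inequality becomes a differential inequality along the whole segment.\<close>

lemma self_concordant_third_deriv_bound:
  fixes f :: "'a::euclidean_space \<Rightarrow> ereal" and u :: 'a
  assumes sc: "std_self_concordant f" and y: "y \<in> dom_of f"
  defines "D \<equiv> dir_deriv u"
  shows "\<bar>D (D (D (fin f))) y\<bar> \<le> 2 * D (D (fin f)) y powr (3/2)"
proof -
  let ?l = "\<lambda>t::real. y + t *\<^sub>R u"
  let ?T = "?l -` dom_of f"
  let ?p = "\<lambda>t. fin f (?l t)"
  have T: "open ?T" "0 \<in> ?T"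
    using sc y by (auto simp: std_self_concordant_def intro!: open_vimage continuous_intros)
  have C: "cont_diff_on 3 (fin f) (dom_of f)" using sc by (simp add: std_self_concordant_def)
  have d1: "deriv ?p t = D (fin f) (?l t)" if "t \<in> ?T" for t
    using has_real_derivative_along_line[OF cont_diff_on_3D(1)[OF C]] that
    by (intro DERIV_imp_deriv) (auto simp: D_def)
  have d2: "deriv (deriv ?p) t = D (D (fin f)) (?l t)" if "t \<in> ?T" for t
    using has_real_derivative_along_line[OF cont_diff_on_3D(2)[OF C]] that
    by (intro deriv_eq_on_open[OF T(1) that d1]) (auto simp: D_def)
  have d3: "deriv (deriv (deriv ?p)) t = D (D (D (fin f))) (?l t)" if "t \<in> ?T" for t
    using has_real_derivative_along_line[OF cont_diff_on_3D(3)[OF C]] that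
    by (intro deriv_eq_on_open[OF T(1) that d2]) (auto simp: D_def)
  have "\<bar>(deriv ^^ 3) ?p 0\<bar> \<le> 2 * ((deriv ^^ 2) ?p 0) powr (3/2)"
    using sc y by (auto simp: std_self_concordant_def Let_def)
  thus ?thesis using d2[OF T(2)] d3[OF T(2)] by (simp add: numeral_3_eq_3 numeral_2_eq_2)
qed

text \<open>This is the one-dimensional bound for the restriction of \<open>f\<close> to the segment from \<open>y\<close> to \<open>y + u\<close>,
  which lies in the domain by convexity.\<close>

lemma self_concordant_lower_bound:
  assumes sc: "std_self_concordant f" and y: "y \<in> dom_of f" and z: "y + u \<in> dom_of f"
    and pos: "\<And>v. v \<in> dom_of f \<Longrightarrow> dir_deriv u (dir_deriv u (fin f)) v > 0"
  shows "fin f y + dir_deriv u (fin f) y + omega (sqrt (dir_deriv u (dir_deriv u (fin f)) y))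
           \<le> fin f (y + u)"
proof -
  let ?l = "\<lambda>t::real. y + t *\<^sub>R u"
  have C: "cont_diff_on 3 (fin f) (dom_of f)" using sc by (simp add: std_self_concordant_def)
  have cv: "convex (dom_of f)"
    using sc by (auto simp: std_self_concordant_def closed_convex_fun_def convex_on_def)
  have l: "?l t \<in> dom_of f" if "t \<in> {0..1}" for t
    using convexD_alt[OF cv y z, of t] that by (simp add: algebra_simps)
  have "fin f (?l 0) + dir_deriv u (fin f) (?l 0)
          + omega (sqrt (dir_deriv u (dir_deriv u (fin f)) (?l 0))) \<le> fin f (?l 1)"
  proof (rule self_concordant_line_lower_bound)
    fix t :: real assume t: "t \<in> {0..1}"
    note lt = l[OF t]
    note h = has_real_derivative_along_line[of _ y t u]
    show "((\<lambda>t. fin f (?l t)) has_real_derivative dir_deriv u (fin f) (?l t)) (at t)"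
      by (rule h[OF cont_diff_on_3D(1)[OF C lt]])
    show "((\<lambda>t. dir_deriv u (fin f) (?l t)) has_real_derivative
             dir_deriv u (dir_deriv u (fin f)) (?l t)) (at t)"
      by (rule h[OF cont_diff_on_3D(2)[OF C lt]])
    show "((\<lambda>t. dir_deriv u (dir_deriv u (fin f)) (?l t)) has_real_derivative
             dir_deriv u (dir_deriv u (dir_deriv u (fin f))) (?l t)) (at t)"
      by (rule h[OF cont_diff_on_3D(3)[OF C lt]])
    show "0 < dir_deriv u (dir_deriv u (fin f)) (?l t)" by (rule pos[OF lt])
    show "- (2 * dir_deriv u (dir_deriv u (fin f)) (?l t) powr (3/2))
            \<le> dir_deriv u (dir_deriv u (dir_deriv u (fin f))) (?l t)"
      using self_concordant_third_deriv_bound[OF sc lt, of u] by linarith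
  qed
  thus ?thesis by simp
qed

section \<open>Gradient, Hessian and the optimality gap\<close>

text \<open>The Riesz representation of the derivative exhibits the vector whose existence and uniqueness make
  the description in the definition of \<open>grad\<close> meaningful.\<close>

lemma grad_inner:
  fixes f :: "real^'n \<Rightarrow> ereal"
  assumes "fin f differentiable (at y)"
  shows "grad f y \<bullet> u = dir_deriv u (fin f) y"
proof -
  let ?D = "frechet_derivative (fin f) (at y)"
  have D: "(fin f has_derivative ?D) (at y)"
    using assms frechet_derivative_works by blast
  interpret D: linear ?D by (rule has_derivative_linear[OF D])
  define g where "g = (\<Sum>b\<in>Basis. ?D b *\<^sub>R b)"
  have g: "?D h = h \<bullet> g" for h
  proof -
    have "?D h = ?D (\<Sum>b\<in>Basis. (h \<bullet> b) *\<^sub>R b)" by (simp add: euclidean_representation)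
    also have "\<dots> = (\<Sum>b\<in>Basis. (h \<bullet> b) * ?D b)" by (simp add: D.sum D.scale)
    also have "\<dots> = h \<bullet> g" by (simp add: g_def inner_sum_right mult.commute)
    finally show ?thesis .
  qed
  hence G: "GDERIV (fin f) y :> g" using D by (simp add: gderiv_def flip: g)
  have "grad f y = g"
    unfolding grad_def
  proof (rule the_equality)
    show "GDERIV (fin f) y :> g" by (rule G)
    fix g' assume "GDERIV (fin f) y :> g'"
    hence "(\<lambda>h. h \<bullet> g') = (\<lambda>h. h \<bullet> g)"
      using G has_derivative_unique unfolding gderiv_def by blast
    thus "g' = g" by (metis vector_eq_ldot)
  qed
  thus ?thesis by (simp add: dir_deriv_def g inner_commute)
qed

text \<open>On the open domain, every function \<open>v \<mapsto> grad f v \<bullet> h\<close> agrees with a directional derivative of \<open>f\<close>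
  and is therefore differentiable. Componentwise this gives differentiability of the gradient, so that
  the Jacobian defining \<open>hess\<close> really is its derivative.\<close>

lemma hess_quadratic_form:
  fixes f :: "real^'n \<Rightarrow> ereal"
  assumes C: "cont_diff_on 3 (fin f) (dom_of f)" and o: "open (dom_of f)" and y: "y \<in> dom_of f"
  shows "u \<bullet> (hess f y *v u) = dir_deriv u (dir_deriv u (fin f)) y"
proof -
  have gi: "grad f v \<bullet> h = dir_deriv h (fin f) v" if "v \<in> dom_of f" for v h
    by (rule grad_inner[OF cont_diff_on_3D(1)[OF C that]])
  have tr: "((\<lambda>v. grad f v \<bullet> h) has_derivative frechet_derivative (dir_deriv h (fin f)) (at y)) (at y)" for h
  proof (rule has_derivative_transform_within_open[OF _ o y])
    show "(dir_deriv h (fin f) has_derivative frechet_derivative (dir_deriv h (fin f)) (at y)) (at y)"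
      using cont_diff_on_3D(2)[OF C y] frechet_derivative_works by blast
  qed (simp add: gi)
  have "grad f differentiable (at y)"
    using tr by (subst differentiable_componentwise_within) (auto simp: differentiable_def)
  hence H: "(grad f has_derivative (\<lambda>h. hess f y *v h)) (at y)"
    unfolding hess_def using jacobian_works by blast
  have "((\<lambda>v. grad f v \<bullet> u) has_derivative (\<lambda>h. (hess f y *v h) \<bullet> u)) (at y)"
    using H by (rule has_derivative_inner_left)
  hence "(\<lambda>h. (hess f y *v h) \<bullet> u) = frechet_derivative (dir_deriv u (fin f)) (at y)"
    using tr has_derivative_unique by blast
  thus ?thesis by (metis dir_deriv_def inner_commute)
qed

text \<open>The usual argument: the quadratic form is nonnegative at the residual of the \<open>A\<close>-orthogonal projection of
  \<open>u\<close> onto \<open>v\<close>, and the symmetry of \<open>A\<close> identifies the two cross terms.\<close>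

lemma pos_def_cauchy_schwarz:
  assumes "pos_def A"
  shows "\<bar>u \<bullet> (A *v v)\<bar> \<le> sqrt (u \<bullet> (A *v u)) * sqrt (v \<bullet> (A *v v))"
proof (cases "v = 0")
  case False
  define a b c where "a = u \<bullet> (A *v u)" and "b = u \<bullet> (A *v v)" and "c = v \<bullet> (A *v v)"
  have c: "c > 0" using assms False by (simp add: pos_def_def c_def)
  have sym: "v \<bullet> (A *v u) = b"
    using assms unfolding pos_def_def b_def
    by (metis dot_lmul_matrix inner_commute transpose_matrix_vector)
  have psd: "w \<bullet> (A *v w) \<ge> 0" for w
    using assms by (cases "w = 0") (auto simp: pos_def_def intro: less_imp_le)
  have "0 \<le> (u - (b / c) *\<^sub>R v) \<bullet> (A *v (u - (b / c) *\<^sub>R v))" by (rule psd)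
  also have "\<dots> = a - b\<^sup>2 / c"
    using c sym
    by (simp add: matrix_vector_mult_diff_distrib matrix_vector_mult_scaleR inner_diff_left
        inner_diff_right a_def[symmetric] b_def[symmetric] c_def[symmetric] power2_eq_square)
  finally have "b\<^sup>2 \<le> a * c" using c by (simp add: field_simps)
  hence "sqrt (b\<^sup>2) \<le> sqrt (a * c)" by (rule real_sqrt_le_mono)
  thus ?thesis by (simp add: a_def b_def c_def real_sqrt_mult)
qed simp

lemma hess_newton_dir:
  fixes f :: "real^'n \<Rightarrow> ereal"
  assumes "pos_def (hess f y)"
  shows "hess f y *v newton_dir f y = - grad f y"
proof -
  have "invertible (hess f y)"
    using assms unfolding invertible_left_inverse matrix_left_invertible_ker pos_def_def
    by (metis inner_zero_right less_irrefl)
  hence "hess f y ** matrix_inv (hess f y) = mat 1"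
    unfolding invertible_def matrix_inv_def by (metis (mono_tags, lifting) someI_ex)
  thus ?thesis
    unfolding newton_dir_def
    by (metis matrix_vector_mul_assoc matrix_vector_mul_lid vec.neg)
qed

lemma newton_dec_nonneg:
  assumes "pos_def (hess f y)"
  shows "newton_dec f y \<ge> 0"
  unfolding newton_dec_def local_norm_def
  using assms by (cases "newton_dir f y = 0") (auto simp: pos_def_def intro: less_imp_le)

text \<open>Let \<open>u = z - y\<close> and let \<open>r\<close> be the local norm of \<open>u\<close> at \<open>y\<close>. By the Newton equation and
  Cauchy-Schwarz the slope of \<open>f\<close> in direction \<open>u\<close> is at least \<open>- newton_dec f y * r\<close>, so \<open>f\<close> falls from
  \<open>y\<close> to \<open>z\<close> by at most \<open>newton_dec f y * r - omega r\<close>. The Young inequality bounds this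
  independently of \<open>r\<close>.\<close>

lemma gap_le_omega_star:
  fixes f :: "real^'n \<Rightarrow> ereal"
  assumes sc: "std_self_concordant f"
    and pd: "\<And>y. y \<in> dom_of f \<Longrightarrow> pos_def (hess f y)"
    and y: "y \<in> dom_of f" and z: "z \<in> dom_of f"
    and lam: "newton_dec f y < 1"
  shows "fin f y - fin f z \<le> omega_star (newton_dec f y)"
proof -
  have C: "cont_diff_on 3 (fin f) (dom_of f)" and o: "open (dom_of f)"
    using sc by (auto simp: std_self_concordant_def)
  note hq = hess_quadratic_form[OF C o]
  define l where "l = newton_dec f y"
  have l0: "l \<ge> 0" unfolding l_def by (rule newton_dec_nonneg[OF pd[OF y]])
  show ?thesis
  proof (cases "z = y")
    case True
    have "omega_star 0 \<le> omega_star l" using l0 lam l_def by (intro omega_star_mono) auto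
    thus ?thesis using True by (simp add: l_def omega_star_def)
  next
    case False
    define u where "u = z - y"
    have u: "u \<noteq> 0" "y + u = z" using False by (auto simp: u_def)
    define r where "r = sqrt (u \<bullet> (hess f y *v u))"
    have pos: "dir_deriv u (dir_deriv u (fin f)) v > 0" if "v \<in> dom_of f" for v
      using pd[OF that] u(1) unfolding hq[OF that, of u, symmetric] by (simp add: pos_def_def)
    have "r \<ge> 0" unfolding r_def using pos[OF y] hq[OF y, of u] by simp
    have "fin f y + dir_deriv u (fin f) y + omega r \<le> fin f z"
      using self_concordant_lower_bound[OF sc y _ pos] z u(2) hq[OF y, of u]
      by (simp add: r_def)
    moreover have "dir_deriv u (fin f) y = - (u \<bullet> (hess f y *v newton_dir f y))"
      using grad_inner[OF cont_diff_on_3D(1)[OF C y], of u] hess_newton_dir[OF pd[OF y]]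
      by (simp add: inner_commute)
    moreover have "\<bar>u \<bullet> (hess f y *v newton_dir f y)\<bar> \<le> r * l"
      using pos_def_cauchy_schwarz[OF pd[OF y], of u "newton_dir f y"]
      by (simp add: r_def l_def newton_dec_def local_norm_def)
    moreover have "l * r \<le> omega r + omega_star l"
      using \<open>r \<ge> 0\<close> lam l_def by (intro omega_fenchel_young) auto
    ultimately show ?thesis by (simp add: l_def mult.commute)
  qed
qed

section \<open>Counting iterations\<close>

text \<open>The counting argument, free of any geometry: \<open>\<delta>\<close> is the optimality gap, \<open>w\<close> is \<open>omega\<close> of the Newton
  decrement and \<open>W\<close> is the threshold for \<open>w\<close> below which it halves. Write \<open>A\<close> and \<open>B\<close> for the
  arguments of the minimum and \<open>L\<close> for the rounded logarithm. Each of \<open>A\<close> and \<open>B\<close> bounds the time by which \<open>w \<le> W\<close> has occurred. For \<open>A\<close> the gap has then shrunk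
  geometrically to \<open>W / 2\<close>, and the next step can decrease it by no more than that; for \<open>B\<close> each
  earlier step would have consumed more than \<open>W / 2\<close> of the initial gap. From then on the gap is at
  most \<open>2 * W / 2 ^ j\<close> after \<open>j\<close> more steps, and \<open>L\<close> of them suffice.

  If \<open>\<epsilon>\<close> exceeds \<open>2 * W\<close> then \<open>L\<close> may be negative, and the claim is that the
  goal is reached \<open>m = - L\<close> steps \<^emph>\<open>before\<close> the end of the first phase. This holds because
  \<open>2 * W * 2 ^ m \<le> \<epsilon>\<close>: undoing \<open>m\<close> geometric steps multiplies the bound \<open>W / 2\<close> by at most \<open>2 ^ m\<close>
  (this is where \<open>1/2 \<le> q\<close> enters), and \<open>m\<close> steps of the additive bound are worth only \<open>m * W / 2\<close>.\<close>

lemma two_phase_within: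
  fixes \<delta> w :: "nat \<Rightarrow> real"
  assumes nn: "\<And>k. 0 \<le> \<delta> k" "\<And>k. 0 \<le> w k"
    and dec: "\<And>k. \<delta> (Suc k) \<le> \<delta> k - w k / 2"
    and contr: "\<And>k. w k \<le> W \<Longrightarrow> w (Suc k) \<le> w k / 2"
    and gap: "\<And>k. w k \<le> W \<Longrightarrow> \<delta> k \<le> 2 * w k"
    and pos: "W > 0" "\<epsilon> > 0"
    and q: "1/2 \<le> q" "q < 1" "\<And>k. \<delta> (Suc k) \<le> q * \<delta> k"
    and d0: "\<delta> 0 > 0"
  shows "\<exists>k. k \<le> nat (min \<lceil>max 0 ((ln (1/2 * W) - ln (\<delta> 0)) / ln q)\<rceil> \<lceil>2 * \<delta> 0 / W\<rceil>
                     + \<lceil>log 2 (2 * W / \<epsilon>)\<rceil>) \<and> \<delta> k \<le> \<epsilon>"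
proof -
  define A B L where "A = \<lceil>max 0 ((ln (1/2 * W) - ln (\<delta> 0)) / ln q)\<rceil>"
    and "B = \<lceil>2 * \<delta> 0 / W\<rceil>" and "L = \<lceil>log 2 (2 * W / \<epsilon>)\<rceil>"
  have A0: "A \<ge> 0" unfolding A_def by (simp add: le_max_iff_disj)
  have B0: "B \<ge> 0" unfolding B_def using d0 pos by (simp add: less_le_trans[of "-1" 0])
  have "\<delta> (Suc k) \<le> \<delta> k" for k using dec[of k] nn(2)[of k] by linarith
  hence decr: "\<delta> j \<le> \<delta> i" if "i \<le> j" for i j
    using that by (rule lift_Suc_antimono_le)
  have geom: "\<delta> n \<le> q ^ n * \<delta> 0" for n
  proof (induction n)
    case (Suc n)
    have "\<delta> (Suc n) \<le> q * \<delta> n" by (rule q)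
    also have "\<dots> \<le> q * (q ^ n * \<delta> 0)" using Suc q by (intro mult_left_mono) auto
    finally show ?case by (simp add: mult_ac)
  qed simp
  have slow: "\<delta> n \<le> \<delta> 0 - n * W / 2" if "\<And>i. i < n \<Longrightarrow> w i > W" for n
    using that
  proof (induction n)
    case (Suc n)
    have "\<delta> (Suc n) \<le> \<delta> n - w n / 2" "\<delta> n \<le> \<delta> 0 - n * W / 2" "w n > W"
      using dec Suc by auto
    thus ?case by (simp add: field_simps)
  qed simp
  have halve: "w (k + j) \<le> w k / 2 ^ j \<and> w (k + j) \<le> W" if "w k \<le> W" for k j
  proof (induction j)
    case (Suc j)
    have "w (k + Suc j) \<le> w (k + j) / 2" using contr[of "k + j"] Suc by simp
    moreover have "w (k + j) / 2 \<le> w k / 2 ^ Suc j" using Suc by simp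
    ultimately show ?case using nn(2)[of "k + j"] Suc by linarith
  qed (use that in auto)
  have fast: "\<delta> (k + j) \<le> 2 * W / 2 ^ j" if "w k \<le> W" for k j
  proof -
    have "\<delta> (k + j) \<le> 2 * w (k + j)" using halve[OF that] gap by blast
    also have "\<dots> \<le> 2 * (w k / 2 ^ j)" using halve[OF that, of j] by auto
    also have "\<dots> \<le> 2 * (W / 2 ^ j)" using that by (simp add: field_simps)
    finally show ?thesis by simp
  qed
  have lnq: "ln q < 0" using q by simp
  have rate: "q ^ n * \<delta> 0 \<le> W / 2" if "A \<le> int n" for n
  proof -
    have "(ln (W / 2) - ln (\<delta> 0)) / ln q \<le> n"
      using that unfolding A_def by (simp add: ceiling_le_iff)
    hence "n * ln q \<le> ln (W / 2) - ln (\<delta> 0)"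
      using lnq by (simp add: neg_divide_le_eq)
    hence "ln (q ^ n * \<delta> 0) \<le> ln (W / 2)"
      using q d0 by (simp add: ln_mult ln_realpow)
    thus ?thesis using q d0 pos by (subst (asm) ln_le_cancel_iff) auto
  qed
  have "2 * W / \<epsilon> = 2 powr (log 2 (2 * W / \<epsilon>))" using pos by (simp del: log_divide)
  also have "\<dots> \<le> 2 powr L" unfolding L_def by (intro powr_mono) auto
  finally have epsL: "2 * W / \<epsilon> \<le> 2 powr L" .
  have "\<exists>k\<le>nat (M + L). \<delta> k \<le> \<epsilon>" if M: "M = A \<or> M = B" for M
  proof (cases "L \<ge> 0")
    case True
    have "\<exists>k\<le>nat M. w k \<le> W"
    proof (cases "M = A")
      case True
      have "0 \<le> \<delta> (Suc (nat A))" by (rule nn)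
      also have "\<dots> \<le> \<delta> (nat A) - w (nat A) / 2" by (rule dec)
      also have "\<delta> (nat A) \<le> W / 2" using geom[of "nat A"] rate[of "nat A"] A0 by simp
      finally show ?thesis using True by auto
    next
      case False
      hence [simp]: "M = B" using M by simp
      show ?thesis
      proof (rule ccontr)
        assume "\<not> ?thesis"
        hence *: "w i > W" if "i \<le> nat B" for i using that by force
        have "0 \<le> \<delta> 0 - real (Suc (nat B)) * W / 2"
          using slow[of "Suc (nat B)"] * nn(1)[of "Suc (nat B)"] by force
        moreover have "2 * \<delta> 0 / W \<le> nat B" using B0 unfolding B_def by simp
        ultimately show False using pos by (simp add: field_simps)
      qed
    qed
    then obtain k where k: "k \<le> nat M" "w k \<le> W" by blast
    have "\<delta> (k + nat L) \<le> 2 * W / 2 ^ nat L" by (rule fast[OF k(2)])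
    also have "\<dots> \<le> \<epsilon>" using epsL True pos
      by (simp add: field_simps powr_realpow[symmetric])
    finally show ?thesis using k A0 B0 M True by (intro exI[of _ "k + nat L"]) auto
  next
    case False
    define m where "m = nat (- L)"
    have Lm: "L = - int m" using False by (simp add: m_def)
    have eps: "2 * W * 2 ^ m \<le> \<epsilon>"
      using epsL pos unfolding Lm by (simp add: powr_minus powr_realpow field_simps)
    define n where "n = nat (M + L)"
    have n: "M \<le> int (n + m)" unfolding n_def Lm by simp
    have "\<delta> n \<le> \<epsilon>"
    proof (cases "M = A")
      case True
      have "q ^ n * \<delta> 0 * (1/2) ^ m \<le> q ^ n * \<delta> 0 * q ^ m"
        using q d0 by (intro mult_left_mono power_mono) auto
      also have "\<dots> = q ^ (n + m) * \<delta> 0" by (simp add: power_add)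
      also have "\<dots> \<le> W / 2" using rate n True by simp
      finally have "q ^ n * \<delta> 0 \<le> W / 2 * 2 ^ m" by (simp add: field_simps)
      also have "\<dots> \<le> 2 * W * 2 ^ m" using pos by simp
      finally show ?thesis using geom[of n] eps by simp
    next
      case False
      show ?thesis
      proof (rule ccontr)
        assume c: "\<not> \<delta> n \<le> \<epsilon>"
        \<comment> \<open>A gap above \<open>2 * W\<close> rules out the halving regime.\<close>
        have "w i > W" if "i < n" for i
        proof (rule ccontr)
          assume "\<not> w i > W"
          hence "\<delta> i \<le> 2 * W" using gap[of i] by simp
          also have "\<dots> \<le> 2 * W * 2 ^ m" using pos by simp
          finally show False using eps c decr[of i n] that by simp
        qed
        hence "2 * W * 2 ^ m < \<delta> 0 - n * W / 2" using slow[of n] c eps by simp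
        moreover have "2 * \<delta> 0 / W \<le> real (n + m)"
          using n False M unfolding B_def by (simp add: ceiling_le_iff)
        hence "\<delta> 0 - n * W / 2 \<le> m * W / 2" using pos by (simp add: field_simps)
        ultimately have "W * (2 * 2 ^ m) < W * (m / 2)" by (simp add: mult_ac)
        hence "2 * 2 ^ m < m / (2::real)" using pos by simp
        moreover have "real m < 2 ^ m" by (rule of_nat_less_two_power)
        ultimately show False by simp
      qed
    qed
    thus ?thesis unfolding n_def by blast
  qed
  from this[of "min A B"] show ?thesis unfolding A_def B_def L_def by (auto simp: min_def)
qed

section \<open>The iteration bound\<close>

theorem theorem4p5:
  fixes f :: "real^'n \<Rightarrow> ereal"
    and x0 :: "real^'n"
    and x dhat :: "nat \<Rightarrow> real^'n"
    and \<epsilon> \<delta>0 :: real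
  assumes sc: "std_self_concordant f"
    and pd: "\<And>y. y \<in> dom_of f \<Longrightarrow> pos_def (hess f y)"
    and opt: "\<exists>!z. is_arg_min f (\<lambda>_. True) z"
    and x0: "x0 \<in> dom_of f"
    and eps: "\<epsilon> > 0"
    and iterates: "inexact_DN f x0 dhat x"
    and decrease: "\<And>k. f (x (Suc k)) \<le> f (x k) - ereal (1/2 * omega (newton_dec f (x k)))"
    and contract: "\<And>k. newton_dec f (x k) \<le> 1/6 \<Longrightarrow>
                     omega (newton_dec f (x (Suc k))) \<le> 1/2 * omega (newton_dec f (x k))"
    and delta0: "\<delta>0 = real_of_ereal (f x0 - opt_val f)"
  shows "\<exists>k. k \<le> nat (min
              \<lceil>max 0 ((ln (1/2 * omega (1/6)) - ln \<delta>0) /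
                 ln (1 - (1 - omega_star_inv \<delta>0) / (2 * (1 + omega_star_inv \<delta>0))))\<rceil>
              \<lceil>2 * \<delta>0 / omega (1/6)\<rceil>
            + \<lceil>log 2 (2 * omega (1/6) / \<epsilon>)\<rceil>)
          \<and> f (x k) - opt_val f \<le> ereal \<epsilon>"
proof -
  have C: "closed_convex_fun f" using sc by (simp add: std_self_concordant_def)
  have real_val: "f y = ereal (fin f y)" if "y \<in> dom_of f" for y
    using that C by (cases "f y") (auto simp: dom_of_def closed_convex_fun_def fin_def)
  obtain z where "is_arg_min f (\<lambda>_. True) z" using opt by blast
  hence zmin: "f z \<le> f y" for y by (simp add: is_arg_min_linorder)
  have zdom: "z \<in> dom_of f"
    using zmin[of x0] x0 by (auto simp: dom_of_def intro: le_less_trans)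
  have "opt_val f = f z"
    unfolding opt_val_def by (intro antisym INF_lower INF_greatest) (auto simp: zmin)
  hence opt_z: "opt_val f = ereal (fin f z)" using real_val[OF zdom] by simp
  have xdom: "x k \<in> dom_of f" for k
    using iterates by (simp add: inexact_DN_def)
  have x_0: "x 0 = x0" using iterates by (simp add: inexact_DN_def)
  define \<delta> where "\<delta> = (\<lambda>k. fin f (x k) - fin f z)"
  define lam where "lam = (\<lambda>k. newton_dec f (x k))"
  define s where "s = omega_star_inv \<delta>0"
  have gap_val: "f (x k) - opt_val f = ereal (\<delta> k)" for k
    by (simp add: opt_z real_val[OF xdom] \<delta>_def)
  have \<delta>0: "\<delta>0 = \<delta> 0" unfolding delta0 using gap_val[of 0] x_0 by simp
  have \<delta>_nonneg: "0 \<le> \<delta> k" for k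
    using zmin[of "x k"] by (simp add: real_val[OF xdom] real_val[OF zdom] \<delta>_def)
  have lam_nonneg: "0 \<le> lam k" for k
    unfolding lam_def by (rule newton_dec_nonneg[OF pd[OF xdom]])
  have gap: "\<delta> k \<le> omega_star (lam k)" if "lam k < 1" for k
    unfolding \<delta>_def lam_def
    by (rule gap_le_omega_star[OF sc pd xdom zdom]) (use that lam_def in auto)
  have step: "\<delta> (Suc k) \<le> \<delta> k - omega (lam k) / 2" for k
    using decrease[of k] by (simp add: real_val[OF xdom] \<delta>_def lam_def)
  have omega_lam_nonneg: "0 \<le> omega (lam k)" for k
    using lam_nonneg[of k] by (intro omega_nonneg) simp
  have \<delta>_le: "\<delta> k \<le> \<delta>0" for k
  proof (induction k)
    case (Suc k)
    thus ?case using step[of k] omega_lam_nonneg[of k] by simp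
  qed (simp add: \<delta>0)
  have near: "lam k \<le> 1/6" if "omega (lam k) \<le> omega (1/6)" for k
    using omega_strict_mono[of "1/6" "lam k"] that by force
  show ?thesis
  proof (cases "\<delta> 0 = 0")
    case True
    \<comment> \<open>The bound contains \<open>ln \<delta>0\<close>, which carries no information here, but \<open>x0\<close> is already optimal.\<close>
    thus ?thesis using gap_val[of 0] eps by (intro exI[of _ 0]) simp
  next
    case False
    hence pos: "\<delta> 0 > 0" using \<delta>_nonneg[of 0] by simp
    have s: "0 \<le> s" "s < 1"
      unfolding s_def using pos \<delta>0 by (auto intro!: omega_star_inv_props)
    define q where "q = 1 - (1 - s) / (2 * (1 + s))"
    have "\<exists>k. k \<le> nat (min \<lceil>max 0 ((ln (1/2 * omega (1/6)) - ln (\<delta> 0)) / ln q)\<rceil>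
                \<lceil>2 * \<delta> 0 / omega (1/6)\<rceil> + \<lceil>log 2 (2 * omega (1/6) / \<epsilon>)\<rceil>) \<and> \<delta> k \<le> \<epsilon>"
    proof (rule two_phase_within[where w = "\<lambda>k. omega (lam k)"])
      show "omega (1/6) > 0" using omega_strict_mono[of 0 "1/6"] by (simp add: omega_def)
      show "1/2 \<le> q" "q < 1" using s by (auto simp: q_def field_simps)
      fix k
      show "omega (lam (Suc k)) \<le> omega (lam k) / 2" if "omega (lam k) \<le> omega (1/6)"
        using contract[of k] near[OF that] by (simp add: lam_def)
      show "\<delta> k \<le> 2 * omega (lam k)" if "omega (lam k) \<le> omega (1/6)"
      proof -
        have l: "lam k \<le> 1/6" by (rule near[OF that])
        have d: "\<delta> k \<le> omega_star (lam k)" using l by (intro gap) simp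
        \<comment> \<open>The quotient \<open>(1 - t) / (1 + t)\<close> is at least \<open>1/2\<close> as long as \<open>t \<le> 1/3\<close>.\<close>
        have "1/2 * omega_star (lam k) \<le> (1 - lam k) / (1 + lam k) * omega_star (lam k)"
          using l lam_nonneg[of k] d \<delta>_nonneg[of k]
          by (intro mult_right_mono) (auto simp: field_simps)
        also have "\<dots> \<le> omega (lam k)"
          using l lam_nonneg[of k] by (intro omega_star_le_omega) auto
        finally show ?thesis using d by simp
      qed
      show "\<delta> (Suc k) \<le> q * \<delta> k"
      proof -
        define c where "c = (1 - s) / (1 + s)"
        have "c * \<delta> k \<le> omega (lam k)"
          unfolding c_def s_def using gap \<delta>_le \<delta>_nonneg lam_nonneg
          by (intro omega_lower_linear) auto
        moreover have qc: "q = 1 - c / 2" by (simp add: q_def c_def)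
        have "q * \<delta> k = \<delta> k - c * \<delta> k / 2" unfolding qc by (simp add: algebra_simps)
        ultimately show ?thesis using step[of k] by linarith
      qed
    qed (use \<delta>_nonneg omega_lam_nonneg step eps pos in auto)
    thus ?thesis by (simp add: gap_val \<delta>0 q_def s_def)
  qed
qed

end
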